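(* Let $r$ be an odd positive integer, $n=4r$, and $BL_r=2^{2r}+2^r+1$. Let $a\in\{1,\dots,2^n-2\}$ with binary expansion $a=\sum_{m=0}^{n-1}\alpha_m2^m$, and define the $r\times4$ matrix $(a_{i,j})_{0\le i\le r-1,\,0\le j\le3}$ by $a_{i,j}=\alpha_{(i-jr)\bmod n}$ (so $a\equiv\sum_{i,j}a_{i,j}2^{i-jr}\pmod{2^n-1}$). The following are equivalent: (a) $a$ is the inverse of $BL_r$ modulo $2^n-1$; (b) there exists an $r\times4$ matrix $(c_{i,j})$ with entries in $\{0,1,2\}$ such that $$2c_{0,0}-c_{r-1,1}+1=a_{0,2}+a_{0,1}+a_{0,0},$$ $$2c_{0,j}-c_{r-1,j+1}=a_{0,j+2}+a_{0,j+1}+a_{0,j}\quad\text{for } j\in\{1,2,3\},$$ $$2c_{i,j}-c_{i-1,j}=a_{i,j+2}+a_{i,j+1}+a_{i,j}\quad\text{for all } i\in\{1,\dots,r-1\},\ j\in\{0,1,2,3\},$$ where column indices are taken modulo $4$. Moreover, the matrix $(c_{i,j})$ in (b) is unique.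
   Context: Powers $2^{m}$ with arbitrary integer $m$ are understood modulo $2^n-1$, i.e. $2^m=2^{m\bmod n}$. *)

theory Defs
  imports "HOL-Number_Theory.Cong" "Jordan_Normal_Form.Matrix"
begin

definition BL :: "nat \<Rightarrow> int" where
  "BL r = 2 ^ (2 * r) + 2 ^ r + 1"

text \<open>The position \<open>i - j r\<close> is an integer, possibly negative, and is reduced to
  its least non-negative residue modulo \<open>n = 4 r\<close> before indexing the digits.\<close>

definition digit_matrix :: "nat \<Rightarrow> (nat \<Rightarrow> int) \<Rightarrow> int mat" where
  "digit_matrix r \<alpha> =
     mat r 4 (\<lambda>(i, j). \<alpha> (nat ((int i - int j * int r) mod int (4 * r))))"

definition is_carry_matrix :: "nat \<Rightarrow> int mat \<Rightarrow> int mat \<Rightarrow> bool" where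
  "is_carry_matrix r A c \<longleftrightarrow>
     c \<in> carrier_mat r 4 \<and>
     (\<forall>i<r. \<forall>j<4. c $$ (i, j) \<in> {0, 1, 2}) \<and>
     2 * c $$ (0, 0) - c $$ (r - 1, 1) + 1 = A $$ (0, 2) + A $$ (0, 1) + A $$ (0, 0) \<and>
     (\<forall>j\<in>{1, 2, 3}.
        2 * c $$ (0, j) - c $$ (r - 1, (j + 1) mod 4) =
          A $$ (0, (j + 2) mod 4) + A $$ (0, (j + 1) mod 4) + A $$ (0, j)) \<and>
     (\<forall>i\<in>{1..r - 1}. \<forall>j\<in>{0, 1, 2, 3}.
        2 * c $$ (i, j) - c $$ (i - 1, j) =
          A $$ (i, (j + 2) mod 4) + A $$ (i, (j + 1) mod 4) + A $$ (i, j))"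

end

theory Submission
  imports Defs
begin

text \<open>Reading a matrix cyclically, entry \<open>(i, j)\<close> belonging to the residue of \<open>i - j r\<close> modulo
  \<open>n = 4 r\<close>, turns the equations of a carry matrix into the single recursion
  \<open>2 \<gamma>\<^sub>k - \<gamma>\<^sub>k\<^sub>-\<^sub>1 + [k = 0] = s\<^sub>k\<close> over the residues \<open>k\<close> modulo \<open>n\<close>, where
  \<open>s\<^sub>k = \<alpha>\<^sub>k + \<alpha>\<^sub>k\<^sub>-\<^sub>r + \<alpha>\<^sub>k\<^sub>-\<^sub>2\<^sub>r\<close> are the digits, not yet carried, of \<open>a BL\<^sub>r\<close> modulo
  \<open>2\<^sup>n - 1\<close>. Weighting by \<open>2\<^sup>k\<close> and telescoping gives
  \<open>\<Sum>\<^sub>k s\<^sub>k 2\<^sup>k = 1 + (2\<^sup>n - 1) \<gamma>\<^sub>n\<^sub>-\<^sub>1\<close>. So a solution exists only if \<open>a BL\<^sub>r\<close> is congruent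
  to 1, and it is determined by the last carry, hence by the digits. Conversely, the congruence
  provides the last carry as a quotient; the partial sums then determine the other carries, and the
  bounds \<open>0 \<le> s\<^sub>k \<le> 3\<close> force all of them into \<open>{0, 1, 2}\<close>.\<close>

section \<open>Cyclic carry sequences\<close>

definition is_carry_sequence :: "nat \<Rightarrow> (nat \<Rightarrow> int) \<Rightarrow> (nat \<Rightarrow> int) \<Rightarrow> bool" where
  "is_carry_sequence n s \<gamma> \<longleftrightarrow>
     (\<forall>k<n. \<gamma> k \<in> {0, 1, 2}) \<and>
     (\<forall>k<n. 2 * \<gamma> k - \<gamma> (if k = 0 then n - 1 else k - 1) + of_bool (k = 0) = s k)"

text \<open>Weighting equation \<open>k\<close> by \<open>2 ^ k\<close> makes the sum telescope. The
  wrap-around carry \<open>\<gamma> (n - 1)\<close> and the extra 1 enter only at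
  \<open>k = 0\<close>, so both stay as constants. Conversely, subtract consecutive partial sums and
  cancel the power of 2.\<close>

lemma carry_recursion_iff_partial_sums:
  fixes s \<gamma> :: "nat \<Rightarrow> int"
  shows "(\<forall>k<n. 2 * \<gamma> k - \<gamma> (if k = 0 then n - 1 else k - 1) + of_bool (k = 0) = s k) \<longleftrightarrow>
         (\<forall>m<n. (\<Sum>k<Suc m. s k * 2 ^ k) = 2 ^ Suc m * \<gamma> m - \<gamma> (n - 1) + 1)"
    (is "?rec \<longleftrightarrow> ?sums")
proof
  assume rec: ?rec
  have "(\<Sum>k<Suc m. s k * 2 ^ k) = 2 ^ Suc m * \<gamma> m - \<gamma> (n - 1) + 1" if "m < n" for m
    using that
  proof (induction m)
    case 0
    then show ?case using rec[rule_format, of 0] by simp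
  next
    case (Suc m)
    have s: "s (Suc m) = 2 * \<gamma> (Suc m) - \<gamma> m"
      using rec[rule_format, of "Suc m"] Suc.prems by simp
    have IH: "(\<Sum>k<Suc m. s k * 2 ^ k) = 2 ^ Suc m * \<gamma> m - \<gamma> (n - 1) + 1"
      using Suc by simp
    show ?case
      unfolding sum.lessThan_Suc[of _ "Suc m"] IH s by (simp add: algebra_simps)
  qed
  then show ?sums by blast
next
  assume sums: ?sums
  show ?rec
  proof (intro allI impI)
    fix k assume k: "k < n"
    show "2 * \<gamma> k - \<gamma> (if k = 0 then n - 1 else k - 1) + of_bool (k = 0) = s k"
    proof (cases k)
      case 0
      then show ?thesis using sums[rule_format, of 0] k by simp
    next
      case (Suc m)
      have "(\<Sum>k<Suc (Suc m). s k * 2 ^ k) - (\<Sum>k<Suc m. s k * 2 ^ k)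
              = 2 ^ Suc m * (2 * \<gamma> k - \<gamma> m)"
        using sums[rule_format, of k] sums[rule_format, of m] k Suc
        by (simp add: algebra_simps)
      then have "2 ^ Suc m * s k = 2 ^ Suc m * (2 * \<gamma> k - \<gamma> m)"
        unfolding sum.lessThan_Suc[of _ "Suc m"] by (simp add: Suc mult.commute)
      then show ?thesis using Suc by simp
    qed
  qed
qed

lemma is_carry_sequence_iff:
  "is_carry_sequence n s \<gamma> \<longleftrightarrow>
     (\<forall>k<n. \<gamma> k \<in> {0, 1, 2}) \<and>
     (\<forall>m<n. (\<Sum>k<Suc m. s k * 2 ^ k) = 2 ^ Suc m * \<gamma> m - \<gamma> (n - 1) + 1)"
  unfolding is_carry_sequence_def carry_recursion_iff_partial_sums ..

text \<open>This is the partial sum up to \<open>n - 1\<close>, where both carries are the last one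
  and merge into the factor \<open>2 ^ n - 1\<close>.\<close>

lemma carry_sequence_total:
  assumes "is_carry_sequence n s \<gamma>" "n > 0"
  shows "(\<Sum>k<n. s k * 2 ^ k) = 1 + (2 ^ n - 1) * \<gamma> (n - 1)"
proof -
  obtain m where m: "n = Suc m"
    using assms(2) gr0_implies_Suc by blast
  have "(\<Sum>k<Suc m. s k * 2 ^ k) = 2 ^ Suc m * \<gamma> m - \<gamma> (n - 1) + 1"
    using assms(1) m unfolding is_carry_sequence_iff by blast
  then show ?thesis
    unfolding m by (simp del: sum.lessThan_Suc add: algebra_simps)
qed

lemma carry_sequence_unique:
  assumes \<gamma>: "is_carry_sequence n s \<gamma>" and \<delta>: "is_carry_sequence n s \<delta>" and "m < n"
  shows "\<gamma> m = \<delta> m"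
proof (cases "n = 1")
  case True
  \<comment> \<open>The cycle has length one, so the recursion reads
    \<open>\<gamma> 0 + 1 = s 0\<close>.\<close>
  then show ?thesis
    using \<gamma> \<delta> \<open>m < n\<close> unfolding is_carry_sequence_def by auto
next
  case False
  with \<open>m < n\<close> have "n > 0" "(2::int) ^ n - 1 \<noteq> 0" by auto
  then have last: "\<gamma> (n - 1) = \<delta> (n - 1)"
    using carry_sequence_total[OF \<gamma>] carry_sequence_total[OF \<delta>] by simp
  have "(2::int) ^ Suc m * \<gamma> m = 2 ^ Suc m * \<delta> m"
    using \<gamma> \<delta> \<open>m < n\<close> last unfolding is_carry_sequence_iff by fastforce
  then show ?thesis by simp
qed

lemma sum_power2_bounds:
  fixes s :: "nat \<Rightarrow> int"
  assumes "\<And>k. k < m \<Longrightarrow> 0 \<le> s k \<and> s k \<le> b"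
  shows "0 \<le> (\<Sum>k<m. s k * 2 ^ k)" "(\<Sum>k<m. s k * 2 ^ k) \<le> b * (2 ^ m - 1)"
proof -
  show "0 \<le> (\<Sum>k<m. s k * 2 ^ k)"
    using assms by (intro sum_nonneg) auto
  have "(\<Sum>k<m. s k * 2 ^ k) \<le> (\<Sum>k<m. b * 2 ^ k)"
    using assms by (intro sum_mono mult_right_mono) auto
  also have "\<dots> = b * (\<Sum>k<m. 2 ^ k)"
    by (simp add: sum_distrib_left)
  also have "(\<Sum>k<m. (2::int) ^ k) = 2 ^ m - 1"
    by (induction m) auto
  finally show "(\<Sum>k<m. s k * 2 ^ k) \<le> b * (2 ^ m - 1)" .
qed

lemma carry_sequence_exists:
  fixes s :: "nat \<Rightarrow> int"
  assumes "n \<ge> 2" and s: "\<And>k. k < n \<Longrightarrow> 0 \<le> s k \<and> s k \<le> 3"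
    and "[(\<Sum>k<n. s k * 2 ^ k) = 1] (mod (2 ^ n - 1))"
  shows "\<exists>\<gamma>. is_carry_sequence n s \<gamma>"
proof -
  define P where "P m = (\<Sum>k<m. s k * 2 ^ k)" for m
  have P_bounds: "0 \<le> P m" "P m \<le> 3 * (2 ^ m - 1)" if "m \<le> n" for m
    using sum_power2_bounds[of m s 3] s that unfolding P_def by auto
  define N where "N = (2::int) ^ n - 1"
  have N: "N \<ge> 3"
    using power_increasing[OF assms(1), of "2::int"] unfolding N_def by simp
  \<comment> \<open>\<open>Q\<close> is the value that \<open>carry_sequence_total\<close> forces on
    the last carry.\<close>
  obtain Q where Q: "P n - 1 = N * Q"
    using assms(3) unfolding P_def N_def cong_iff_dvd_diff by blast
  have Pn: "0 \<le> P n" "P n \<le> 3 * N"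
    using P_bounds[OF order_refl] unfolding N_def by auto
  have "Q \<ge> 0"
  proof (rule ccontr)
    assume "\<not> Q \<ge> 0"
    then have "N * Q \<le> N * (-1)"
      using N by (intro mult_left_mono) auto
    then show False using Pn N Q by linarith
  qed
  have "Q < 3"
  proof (rule ccontr)
    assume "\<not> Q < 3"
    then have "N * 3 \<le> N * Q"
      using N by (intro mult_left_mono) auto
    then show False using Pn N Q by linarith
  qed
  \<comment> \<open>Substituting \<open>P n = 1 + (2 ^ n - 1) * Q\<close> leaves
    \<open>2 ^ n * Q\<close> minus the digits from position \<open>m\<close> on, all multiples of
    \<open>2 ^ m\<close>. Hence the division defining \<open>\<gamma>\<close> below is
    exact.\<close>
  have dvd: "(2::int) ^ m dvd Q + P m - 1" if "m \<le> n" for m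
  proof -
    have "P n = P m + (\<Sum>k=m..<n. s k * 2 ^ k)"
      unfolding P_def lessThan_atLeast0 using that by (simp add: sum.atLeastLessThan_concat)
    then have "Q + P m - 1 = 2 ^ n * Q - (\<Sum>k=m..<n. s k * 2 ^ k)"
      using Q unfolding N_def by (simp add: algebra_simps)
    moreover have "(2::int) ^ m dvd (\<Sum>k=m..<n. s k * 2 ^ k)"
      by (intro dvd_sum dvd_mult le_imp_power_dvd) auto
    moreover have "(2::int) ^ m dvd 2 ^ n * Q"
      using that by (intro dvd_mult2 le_imp_power_dvd)
    ultimately show ?thesis by simp
  qed
  define \<gamma> where "\<gamma> m = (Q + P (Suc m) - 1) div 2 ^ Suc m" for m
  have \<gamma>: "2 ^ Suc m * \<gamma> m = Q + P (Suc m) - 1" if "m < n" for m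
    using dvd[of "Suc m"] that unfolding \<gamma>_def by (metis Suc_leI dvd_mult_div_cancel)
  \<comment> \<open>The numerator \<open>Q + P (Suc m) - 1\<close> lies between \<open>-1\<close>
    and \<open>3 * 2 ^ Suc m - 2\<close>, while \<open>2 ^ Suc m\<close> divides it.\<close>
  have "\<gamma> m \<in> {0, 1, 2}" if "m < n" for m
  proof -
    have pow: "(2::int) ^ Suc m \<ge> 2" by simp
    have "\<gamma> m \<ge> 0"
    proof (rule ccontr)
      assume "\<not> \<gamma> m \<ge> 0"
      then have "2 ^ Suc m * \<gamma> m \<le> 2 ^ Suc m * (-1)"
        by (intro mult_left_mono) auto
      then show False
        using \<gamma>[OF that] P_bounds(1)[OF Suc_leI[OF that]] \<open>Q \<ge> 0\<close> pow by linarith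
    qed
    moreover have "\<gamma> m < 3"
    proof (rule ccontr)
      assume "\<not> \<gamma> m < 3"
      then have "2 ^ Suc m * 3 \<le> 2 ^ Suc m * \<gamma> m"
        by (intro mult_left_mono) auto
      moreover have "P (Suc m) \<le> 2 ^ Suc m * 3 - 3"
        using P_bounds(2)[OF Suc_leI[OF that]] by simp
      ultimately show False
        using \<gamma>[OF that] \<open>Q < 3\<close> by linarith
    qed
    ultimately show ?thesis by auto
  qed
  \<comment> \<open>This closes the cycle: the carry leaving the top position is the one fed in at
    position 0.\<close>
  moreover have "\<gamma> (n - 1) = Q"
  proof -
    have "2 ^ n * \<gamma> (n - 1) = 2 ^ n * Q"
      using \<gamma>[of "n - 1"] Q assms(1) unfolding N_def by (simp add: algebra_simps flip: power_Suc)
    then show ?thesis by simp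
  qed
  ultimately have "is_carry_sequence n s \<gamma>"
    unfolding is_carry_sequence_iff using \<gamma> unfolding P_def by fastforce
  then show ?thesis by blast
qed

section \<open>Cyclic shifts of binary digits\<close>

lemma cong_power_mod_exponent:
  "[x ^ (k mod n) = x ^ k] (mod (x ^ n - 1))" for x :: int
proof -
  have "[(x ^ n) ^ (k div n) * x ^ (k mod n) = 1 ^ (k div n) * x ^ (k mod n)] (mod (x ^ n - 1))"
    by (intro cong_mult cong_pow) (auto simp: cong_iff_dvd_diff)
  then show ?thesis
    by (simp add: cong_sym_eq flip: power_mult power_add)
qed

text \<open>Since \<open>2 ^ n\<close> is congruent to 1, multiplication by \<open>2 ^ t\<close>
  rotates the digits. Reading backwards by \<open>t\<close> is reading forwards by
  \<open>u = n - t\<close>.\<close>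

lemma cong_shift_digits:
  fixes f :: "nat \<Rightarrow> int"
  assumes "t + u = n" "n > 0"
  shows "[2 ^ t * (\<Sum>k<n. f k * 2 ^ k) = (\<Sum>k<n. f ((k + u) mod n) * 2 ^ k)] (mod (2 ^ n - 1))"
proof -
  have inv: "((k + t) mod n + u) mod n = k" "((k + u) mod n + t) mod n = k" if "k < n" for k
    using that assms(1) by (auto simp: mod_add_left_eq add.assoc add.commute[of u t])
  have "(\<Sum>k<n. f ((k + u) mod n) * 2 ^ k) = (\<Sum>k<n. f k * 2 ^ ((k + t) mod n))"
    by (rule sum.reindex_bij_witness[where i = "\<lambda>k. (k + t) mod n" and j = "\<lambda>k. (k + u) mod n"])
      (use assms inv in auto)
  moreover have "[(\<Sum>k<n. f k * 2 ^ ((k + t) mod n)) = (\<Sum>k<n. f k * 2 ^ (k + t))] (mod (2 ^ n - 1))"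
    by (intro cong_sum cong_mult cong_refl cong_power_mod_exponent)
  moreover have "(\<Sum>k<n. f k * 2 ^ (k + t)) = 2 ^ t * (\<Sum>k<n. f k * 2 ^ k)"
    by (simp add: sum_distrib_left power_add mult_ac)
  ultimately show ?thesis by (simp add: cong_sym_eq)
qed

text \<open>The shifts by \<open>- r\<close> and \<open>- 2 r\<close> are written as the shifts by \<open>3 r\<close> and \<open>2 r\<close>, to stay
  within the natural numbers.\<close>

definition product_digits :: "nat \<Rightarrow> (nat \<Rightarrow> int) \<Rightarrow> nat \<Rightarrow> int" where
  "product_digits r \<alpha> k = \<alpha> k + \<alpha> ((k + 3 * r) mod (4 * r)) + \<alpha> ((k + 2 * r) mod (4 * r))"

text \<open>Expand \<open>BL r\<close> and rotate the digits once for each of its powers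
  \<open>2 ^ r\<close> and \<open>2 ^ (2 * r)\<close>.\<close>

lemma cong_sum_product_digits:
  assumes "r > 0"
  shows "[(\<Sum>k<4 * r. \<alpha> k * 2 ^ k) * BL r = (\<Sum>k<4 * r. product_digits r \<alpha> k * 2 ^ k)]
           (mod (2 ^ (4 * r) - 1))"
proof -
  let ?a = "\<Sum>k<4 * r. \<alpha> k * 2 ^ k"
  have "[?a + 2 ^ r * ?a + 2 ^ (2 * r) * ?a =
          ?a + (\<Sum>k<4 * r. \<alpha> ((k + 3 * r) mod (4 * r)) * 2 ^ k)
             + (\<Sum>k<4 * r. \<alpha> ((k + 2 * r) mod (4 * r)) * 2 ^ k)] (mod (2 ^ (4 * r) - 1))"
    by (intro cong_add cong_refl cong_shift_digits) (use assms in auto)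
  then show ?thesis
    by (simp add: BL_def product_digits_def algebra_simps sum.distrib)
qed

section \<open>Carry matrices as carry sequences\<close>

text \<open>For \<open>i < r\<close> and \<open>j < 4\<close> this is the residue of
  \<open>i - j r\<close> modulo \<open>4 r\<close>; the factor \<open>(4 - j) mod 4\<close>
  represents \<open>- j\<close> modulo 4 without leaving the naturals.\<close>

definition cyclic_index :: "nat \<Rightarrow> nat \<Rightarrow> nat \<Rightarrow> nat" where
  "cyclic_index r i j = (4 - j) mod 4 * r + i"

lemma less_4_iff: "j < 4 \<longleftrightarrow> j = 0 \<or> j = 1 \<or> j = 2 \<or> j = 3" for j :: nat
  by auto

lemma cyclic_index_less:
  assumes "i < r"
  shows "cyclic_index r i j < 4 * r"
proof -
  have "(4 - j) mod 4 * r \<le> 3 * r" by (intro mult_right_mono) auto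
  then show ?thesis using assms unfolding cyclic_index_def by linarith
qed

text \<open>Division by \<open>r\<close> writes each position as \<open>q r + i\<close>; it belongs
  to row \<open>i\<close> and to the column \<open>- q\<close> modulo 4.\<close>

lemma all_less_iff_cyclic_index:
  "(\<forall>k<4 * r. P k) \<longleftrightarrow> (\<forall>i<r. \<forall>j<4. P (cyclic_index r i j))"
proof
  assume R: "\<forall>i<r. \<forall>j<4. P (cyclic_index r i j)"
  show "\<forall>k<4 * r. P k"
  proof (intro allI impI)
    fix k assume k: "k < 4 * r"
    then have "r > 0" and "k div r < 4" by (auto simp: less_mult_imp_div_less)
    then have "(4 - (4 - k div r) mod 4) mod 4 = k div r"
      by (auto simp: less_4_iff)
    then have "cyclic_index r (k mod r) ((4 - k div r) mod 4) = k"
      by (simp add: cyclic_index_def)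
    then show "P k" using R \<open>r > 0\<close> by (metis mod_less_divisor zero_less_numeral)
  qed
qed (use cyclic_index_less in blast)

lemma cyclic_index_div_mod:
  assumes "i < r" "j < 4"
  shows "cyclic_index r i j mod r = i" "(4 - cyclic_index r i j div r) mod 4 = j"
  using assms by (auto simp: cyclic_index_def less_4_iff)

lemma digit_matrix_entry:
  assumes "i < r" "j < 4"
  shows "digit_matrix r \<alpha> $$ (i, j) = \<alpha> (cyclic_index r i j)"
proof -
  have "(int i - int j * int r) mod int (4 * r) = int (cyclic_index r i j)"
  proof (rule int_mod_pos_eq)
    \<comment> \<open>For \<open>j > 0\<close> the integer \<open>i - j r\<close> lies in
      \<open>[-3 r, 0)\<close>, so adding \<open>4 r\<close> once reduces it.\<close>
    show "int i - int j * int r = int (4 * r) * (if j = 0 then 0 else - 1) + int (cyclic_index r i j)"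
      using assms(2) by (auto simp: cyclic_index_def less_4_iff)
  qed (use cyclic_index_less[OF assms(1), of j] in \<open>auto simp flip: of_nat_less_iff\<close>)
  then show ?thesis
    using assms by (simp add: digit_matrix_def)
qed

text \<open>\<open>c\<close> and \<open>\<gamma>\<close> are tied only entrywise, so the equivalence
  serves both for a sequence read off a matrix and for a matrix built from a sequence.\<close>

lemma is_carry_matrix_iff:
  assumes "r > 0" and "c \<in> carrier_mat r 4"
    and c: "\<And>i j. i < r \<Longrightarrow> j < 4 \<Longrightarrow> c $$ (i, j) = \<gamma> (cyclic_index r i j)"
  shows "is_carry_matrix r (digit_matrix r \<alpha>) c \<longleftrightarrow>
         is_carry_sequence (4 * r) (product_digits r \<alpha>) \<gamma>"
proof -
  define E where "E k \<longleftrightarrow>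
    2 * \<gamma> k - \<gamma> (if k = 0 then 4 * r - 1 else k - 1) + of_bool (k = 0) = product_digits r \<alpha> k" for k
  \<comment> \<open>One column to the right means subtracting \<open>r\<close>, that is, adding
    \<open>3 r\<close> modulo \<open>4 r\<close>.\<close>
  have digits: "product_digits r \<alpha> (cyclic_index r i j) = \<alpha> (cyclic_index r i ((j + 2) mod 4))
      + \<alpha> (cyclic_index r i ((j + 1) mod 4)) + \<alpha> (cyclic_index r i j)" if "i < r" "j < 4" for i j
  proof -
    have mod: "(q * r + i) mod (4 * r) = q mod 4 * r + i" for q
      using mod_mult2_eq[of "q * r + i" r 4] \<open>i < r\<close> by (simp add: mult.commute)
    have "cyclic_index r i j + 3 * r = ((4 - j) mod 4 + 3) * r + i"
         "cyclic_index r i j + 2 * r = ((4 - j) mod 4 + 2) * r + i"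
      by (simp_all add: cyclic_index_def algebra_simps)
    moreover have "((4 - j) mod 4 + 3) mod 4 = (4 - (j + 1) mod 4) mod 4"
         "((4 - j) mod 4 + 2) mod 4 = (4 - (j + 2) mod 4) mod 4"
      using \<open>j < 4\<close> by (auto simp: less_4_iff)
    ultimately have "(cyclic_index r i j + 3 * r) mod (4 * r) = cyclic_index r i ((j + 1) mod 4)"
         "(cyclic_index r i j + 2 * r) mod (4 * r) = cyclic_index r i ((j + 2) mod 4)"
      by (simp_all only: mod cyclic_index_def)
    then show ?thesis by (simp add: product_digits_def)
  qed
  \<comment> \<open>The predecessor of \<open>- j r\<close> is \<open>(r - 1) - (j + 1) r\<close>:
    the carry into the first row comes from the last row of the next column.\<close>
  have pred0: "(if cyclic_index r 0 j = 0 then 4 * r - 1 else cyclic_index r 0 j - 1)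
      = cyclic_index r (r - 1) ((j + 1) mod 4)" if "j < 4" for j
    using that assms(1) by (auto simp: cyclic_index_def less_4_iff)
  have pred: "(if cyclic_index r i j = 0 then 4 * r - 1 else cyclic_index r i j - 1)
      = cyclic_index r (i - 1) j" if "i \<ge> 1" for i j
    using that by (auto simp: cyclic_index_def)
  \<comment> \<open>Position 0 is the entry \<open>(0, 0)\<close>, hence the single equation with an
    added 1.\<close>
  have zero: "cyclic_index r i j = 0 \<longleftrightarrow> i = 0 \<and> j = 0" if "j < 4" for i j
    using that assms(1) by (auto simp: cyclic_index_def less_4_iff)
  have A: "digit_matrix r \<alpha> $$ (i, j) = \<alpha> (cyclic_index r i j)" if "i < r" "j < 4" for i j
    using digit_matrix_entry that .
  have first_row: "E (cyclic_index r 0 j) \<longleftrightarrow>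
      2 * c $$ (0, j) - c $$ (r - 1, (j + 1) mod 4) + of_bool (j = 0) =
        digit_matrix r \<alpha> $$ (0, (j + 2) mod 4) + digit_matrix r \<alpha> $$ (0, (j + 1) mod 4)
        + digit_matrix r \<alpha> $$ (0, j)" if "j < 4" for j
    unfolding E_def pred0[OF that] digits[OF assms(1) that] using that assms(1)
    by (simp add: A c zero)
  have other_rows: "E (cyclic_index r i j) \<longleftrightarrow>
      2 * c $$ (i, j) - c $$ (i - 1, j) =
        digit_matrix r \<alpha> $$ (i, (j + 2) mod 4) + digit_matrix r \<alpha> $$ (i, (j + 1) mod 4)
        + digit_matrix r \<alpha> $$ (i, j)" if "i \<in> {1..r - 1}" "j < 4" for i j
  proof -
    from that have "i \<ge> 1" "i < r" by auto
    then show ?thesis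
      unfolding E_def pred[OF \<open>i \<ge> 1\<close>] digits[OF \<open>i < r\<close> that(2)] using that(2)
      by (simp add: A c zero)
  qed
  have rows: "(\<forall>i<r. Q i) \<longleftrightarrow> Q 0 \<and> (\<forall>i\<in>{1..r - 1}. Q i)" for Q
  proof -
    have "i < r \<longleftrightarrow> i = 0 \<or> i \<in> {1..r - 1}" for i
      using assms(1) by auto
    then show ?thesis by (simp only:) blast
  qed
  have columns: "(\<forall>j<4. Q j) \<longleftrightarrow> (\<forall>j\<in>{0, 1, 2, 3}. Q j)" for Q :: "nat \<Rightarrow> bool"
    by (auto simp: less_4_iff)
  have "(\<forall>k<4 * r. E k) \<longleftrightarrow>
      (\<forall>j<4. E (cyclic_index r 0 j)) \<and> (\<forall>i\<in>{1..r - 1}. \<forall>j<4. E (cyclic_index r i j))"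
    unfolding all_less_iff_cyclic_index rows ..
  also have "\<dots> \<longleftrightarrow>
     2 * c $$ (0, 0) - c $$ (r - 1, 1) + 1 =
        digit_matrix r \<alpha> $$ (0, 2) + digit_matrix r \<alpha> $$ (0, 1) + digit_matrix r \<alpha> $$ (0, 0) \<and>
     (\<forall>j\<in>{1, 2, 3}. 2 * c $$ (0, j) - c $$ (r - 1, (j + 1) mod 4) =
        digit_matrix r \<alpha> $$ (0, (j + 2) mod 4) + digit_matrix r \<alpha> $$ (0, (j + 1) mod 4)
        + digit_matrix r \<alpha> $$ (0, j)) \<and>
     (\<forall>i\<in>{1..r - 1}. \<forall>j\<in>{0, 1, 2, 3}. 2 * c $$ (i, j) - c $$ (i - 1, j) =
        digit_matrix r \<alpha> $$ (i, (j + 2) mod 4) + digit_matrix r \<alpha> $$ (i, (j + 1) mod 4)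
        + digit_matrix r \<alpha> $$ (i, j))"
    using first_row other_rows unfolding columns by (simp add: numeral_2_eq_2)
  finally have eqs: "(\<forall>k<4 * r. E k) \<longleftrightarrow> \<dots>" .
  have "(\<forall>k<4 * r. \<gamma> k \<in> {0, 1, 2}) \<longleftrightarrow> (\<forall>i<r. \<forall>j<4. c $$ (i, j) \<in> {0, 1, 2})"
    unfolding all_less_iff_cyclic_index using c by simp
  then show ?thesis
    using eqs assms(2) unfolding is_carry_matrix_def is_carry_sequence_def E_def by blast
qed

lemma ex_carry_matrix_iff:
  assumes "r > 0"
  shows "(\<exists>c. is_carry_matrix r (digit_matrix r \<alpha>) c) \<longleftrightarrow>
         (\<exists>\<gamma>. is_carry_sequence (4 * r) (product_digits r \<alpha>) \<gamma>)"
proof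
  assume "\<exists>c. is_carry_matrix r (digit_matrix r \<alpha>) c"
  then obtain c where c: "is_carry_matrix r (digit_matrix r \<alpha>) c" ..
  then have "c \<in> carrier_mat r 4" unfolding is_carry_matrix_def by blast
  then have "is_carry_sequence (4 * r) (product_digits r \<alpha>)
      (\<lambda>k. c $$ (k mod r, (4 - k div r) mod 4))"
    using c by (subst is_carry_matrix_iff[OF assms, symmetric]) (auto simp: cyclic_index_div_mod)
  then show "\<exists>\<gamma>. is_carry_sequence (4 * r) (product_digits r \<alpha>) \<gamma>" by blast
next
  assume "\<exists>\<gamma>. is_carry_sequence (4 * r) (product_digits r \<alpha>) \<gamma>"
  then obtain \<gamma> where \<gamma>: "is_carry_sequence (4 * r) (product_digits r \<alpha>) \<gamma>" ..
  have "is_carry_matrix r (digit_matrix r \<alpha>) (mat r 4 (\<lambda>(i, j). \<gamma> (cyclic_index r i j)))"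
    using \<gamma> by (subst is_carry_matrix_iff[OF assms]) auto
  then show "\<exists>c. is_carry_matrix r (digit_matrix r \<alpha>) c" ..
qed

lemma carry_matrix_unique:
  assumes "r > 0" and c: "is_carry_matrix r (digit_matrix r \<alpha>) c"
    and d: "is_carry_matrix r (digit_matrix r \<alpha>) d"
  shows "c = d"
proof -
  define seq where "seq e k = e $$ (k mod r, (4 - k div r) mod 4)" for e :: "int mat" and k
  have entry: "seq e (cyclic_index r i j) = e $$ (i, j)" if "i < r" "j < 4" for e i j
    using that by (simp add: seq_def cyclic_index_div_mod)
  have carriers: "c \<in> carrier_mat r 4" "d \<in> carrier_mat r 4"
    using c d unfolding is_carry_matrix_def by blast+
  have sequences: "is_carry_sequence (4 * r) (product_digits r \<alpha>) (seq c)"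
       "is_carry_sequence (4 * r) (product_digits r \<alpha>) (seq d)"
    using c d carriers entry by (simp_all flip: is_carry_matrix_iff[OF assms(1)])
  have "c $$ (i, j) = d $$ (i, j)" if "i < r" "j < 4" for i j
    using carry_sequence_unique[OF sequences cyclic_index_less[OF that(1)]] entry that by metis
  then show ?thesis
    using carriers by (intro eq_matI) auto
qed

theorem theorem9:
  fixes r n :: nat and a :: int and \<alpha> :: "nat \<Rightarrow> int"
  assumes "odd r" and "r > 0"
    and "n = 4 * r"
    and "a \<in> {1..2 ^ n - 2}"
    and "\<And>m. m < n \<Longrightarrow> \<alpha> m \<in> {0, 1}"
    and "a = (\<Sum>m<n. \<alpha> m * 2 ^ m)"
  shows "([a * BL r = 1] (mod (2 ^ n - 1)) \<longleftrightarrow>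
            (\<exists>c. is_carry_matrix r (digit_matrix r \<alpha>) c)) \<and>
         (\<exists>\<^sub>\<le>\<^sub>1 c. is_carry_matrix r (digit_matrix r \<alpha>) c)"
proof
  let ?s = "product_digits r \<alpha>"
  \<comment> \<open>Each product digit adds three binary digits, which gives the bound 3 that keeps
    the carries at most 2.\<close>
  have bounds: "0 \<le> ?s k \<and> ?s k \<le> 3" if "k < n" for k
  proof -
    have "(k + 3 * r) mod (4 * r) < n" "(k + 2 * r) mod (4 * r) < n"
      using assms(2,3) by auto
    then have "\<alpha> k \<in> {0, 1}" "\<alpha> ((k + 3 * r) mod (4 * r)) \<in> {0, 1}"
        "\<alpha> ((k + 2 * r) mod (4 * r)) \<in> {0, 1}"
      using assms(5) that by blast+
    then show ?thesis unfolding product_digits_def by auto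
  qed
  have "[a * BL r = 1] (mod (2 ^ n - 1)) \<longleftrightarrow> [(\<Sum>k<n. ?s k * 2 ^ k) = 1] (mod (2 ^ n - 1))"
    using cong_sum_product_digits[OF assms(2), of \<alpha>] by (simp add: assms(3,6) cong_def)
  also have "\<dots> \<longleftrightarrow> (\<exists>\<gamma>. is_carry_sequence n ?s \<gamma>)"
  proof
    assume "[(\<Sum>k<n. ?s k * 2 ^ k) = 1] (mod (2 ^ n - 1))"
    then show "\<exists>\<gamma>. is_carry_sequence n ?s \<gamma>"
      using bounds assms(2,3) by (intro carry_sequence_exists) auto
  next
    assume "\<exists>\<gamma>. is_carry_sequence n ?s \<gamma>"
    then show "[(\<Sum>k<n. ?s k * 2 ^ k) = 1] (mod (2 ^ n - 1))"
      using carry_sequence_total assms(2,3) by (fastforce simp: cong_iff_dvd_diff)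
  qed
  also have "\<dots> \<longleftrightarrow> (\<exists>c. is_carry_matrix r (digit_matrix r \<alpha>) c)"
    using ex_carry_matrix_iff[OF assms(2)] assms(3) by simp
  finally show "[a * BL r = 1] (mod (2 ^ n - 1)) \<longleftrightarrow>
      (\<exists>c. is_carry_matrix r (digit_matrix r \<alpha>) c)" .
  show "\<exists>\<^sub>\<le>\<^sub>1 c. is_carry_matrix r (digit_matrix r \<alpha>) c"
    using carry_matrix_unique[OF assms(2)] by (intro Uniq_I)
qed

end
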